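(* Assume that $\kappa$ is a graphon that is continuous and satisfies $\int_{[0,1]}dy\,\kappa(x,y)>0$ for all $x\in[0,1]$. Set $$\chi^T=\int_{[0,1]}dx\left[\frac1{\mathcal D(x)}\int_{[0,1]}dy\,\kappa(x,y)\,\mathcal T(y)-\mathcal T(x)\right],$$ where $\mathcal D(x)=\int_{[0,1]}dy\,\kappa(x,y)$ and $\mathcal T(x)=\tfrac12\int_{[0,1]^2}dy\,dz\,\kappa(x,y)\kappa(y,z)\kappa(z,x)$. (a) If $\kappa$ is of rank 1, i.e. $\kappa(x,y)=\nu(x)\nu(y)$ for some $\nu\colon[0,1]\to[0,1]$ measurable, strictly positive and continuous, then $\chi^T\ge0$, with equality if and only if $\nu$ is constant. (b) There exist two-block graphons for which $\chi^T<0$.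
   Context: A graphon is a measurable symmetric function $\kappa\colon[0,1]^2\to[0,1]$. A two-block graphon is a graphon of the following form, for some $p\in(0,1)$ and $\alpha,\beta,\gamma\in[0,1]$: $\kappa(x,y)=\alpha$ if $(x,y)\in[0,p]\times[0,p]$; $\kappa(x,y)=\gamma$ if $(x,y)\in[0,p]\times[p,1]\,\cup\,[p,1]\times[0,p]$; and $\kappa(x,y)=\beta$ if $(x,y)\in[p,1]\times[p,1]$. The functions $\mathcal D$ and $\mathcal T$ are called the degree density and the triangle density of $\kappa$. *)

theory Defs
  imports "HOL-Analysis.Analysis"
begin

text \<open>Functions on \<open>[0,1]\<close> and \<open>[0,1]\<^sup>2\<close> are total functions on \<^typ>\<open>real\<close>; only their values
  on the unit interval (square) matter. Measurable means Borel measurable.\<close>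

definition graphon :: "(real \<Rightarrow> real \<Rightarrow> real) \<Rightarrow> bool" where
  "graphon \<kappa> \<longleftrightarrow>
     (\<lambda>(x, y). \<kappa> x y) \<in> borel_measurable (restrict_space borel ({0..1} \<times> {0..1})) \<and>
     (\<forall>x\<in>{0..1}. \<forall>y\<in>{0..1}. \<kappa> x y = \<kappa> y x) \<and>
     (\<forall>x\<in>{0..1}. \<forall>y\<in>{0..1}. \<kappa> x y \<in> {0..1})"

text \<open>The closed blocks overlap on the lines \<open>x = p\<close> and \<open>y = p\<close>. Points lying in several blocks
  take the value of the first one in the order \<open>\<alpha>\<close>, \<open>\<gamma>\<close>, \<open>\<beta>\<close>. These lines are null sets.\<close>

definition two_block_graphon :: "(real \<Rightarrow> real \<Rightarrow> real) \<Rightarrow> bool" where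
  "two_block_graphon \<kappa> \<longleftrightarrow> graphon \<kappa> \<and>
     (\<exists>p\<in>{0<..<1}. \<exists>\<alpha>\<in>{0..1}. \<exists>\<beta>\<in>{0..1}. \<exists>\<gamma>\<in>{0..1}. \<forall>x\<in>{0..1}. \<forall>y\<in>{0..1}.
        \<kappa> x y = (if (x, y) \<in> {0..p} \<times> {0..p} then \<alpha>
                 else if (x, y) \<in> {0..p} \<times> {p..1} \<union> {p..1} \<times> {0..p} then \<gamma>
                 else \<beta>))"

definition degree_density :: "(real \<Rightarrow> real \<Rightarrow> real) \<Rightarrow> real \<Rightarrow> real" where
  "degree_density \<kappa> x = (LINT y:{0..1}|lborel. \<kappa> x y)"

definition triangle_density :: "(real \<Rightarrow> real \<Rightarrow> real) \<Rightarrow> real \<Rightarrow> real" where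
  "triangle_density \<kappa> x =
     1 / 2 * (LINT (y, z):{0..1} \<times> {0..1}|lborel. \<kappa> x y * \<kappa> y z * \<kappa> z x)"

definition chi_T :: "(real \<Rightarrow> real \<Rightarrow> real) \<Rightarrow> real" where
  "chi_T \<kappa> = (LINT x:{0..1}|lborel.
     1 / degree_density \<kappa> x * (LINT y:{0..1}|lborel. \<kappa> x y * triangle_density \<kappa> y)
       - triangle_density \<kappa> x)"

end

theory Submission
  imports Defs
begin

text \<open>
  For a rank 1 graphon \<open>\<kappa>(x,y) = \<nu>(x)\<nu>(y)\<close> every density factorises through the moments
  \<open>m\<^sub>k = \<integral>\<nu>\<^sup>k\<close>: \<open>\<D>(x) = m\<^sub>1 \<nu>(x)\<close> and \<open>\<T>(x) = m\<^sub>2\<^sup>2 \<nu>(x)\<^sup>2 / 2\<close>. The factor \<open>\<nu>(x)\<close>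
  cancels in the average of \<open>\<T>\<close> over the neighbours of \<open>x\<close>, so that
  \<open>\<chi>\<^sup>T = m\<^sub>2\<^sup>2 (m\<^sub>3 - m\<^sub>1 m\<^sub>2) / (2 m\<^sub>1)\<close> (lemma \<open>chi_T_rank_one\<close>). The bracket is the
  covariance of \<open>\<nu>\<close> and \<open>\<nu>\<^sup>2\<close>, which are increasing functions of the same quantity.
  Concretely it is \<open>\<integral>(\<nu> - m\<^sub>1)\<^sup>2 (\<nu> + m\<^sub>1)\<close> (lemma \<open>moment_covariance\<close>), a nonnegative number
  which, by continuity, vanishes only if \<open>\<nu> = m\<^sub>1\<close> everywhere.

  For a two-block graphon \<open>\<D>\<close> and \<open>\<T>\<close> take only two values, \<open>D\<^sub>1, D\<^sub>2\<close> and \<open>T\<^sub>1, T\<^sub>2\<close>, and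
  \<open>\<chi>\<^sup>T = p (1-p) \<gamma> (T\<^sub>1 - T\<^sub>2) (1/D\<^sub>2 - 1/D\<^sub>1)\<close> (lemma \<open>chi_T_two_block\<close>). For \<open>\<gamma> > 0\<close>
  this is negative as soon as vertices of the block with larger degree lie in fewer
  triangles. To achieve this, let the
  first block have no inner edges (\<open>\<alpha> = 0\<close>) but be fully joined to the second (\<open>\<gamma> = 1\<close>). Its
  vertices then only see triangles through the rare inner edges of the second block, while
  a vertex of the second block can close each of its inner edges through either block.
\<close>

section \<open>Double integrals of a graphon\<close>

text \<open>Measurability on the unit square is inherited by all compositions once the graphon is
  extended by zero; boundedness then makes the triangle integrand integrable, so that the
  integral over the square can be computed one variable at a time.\<close>

lemma triangle_density_iterated:
  assumes "graphon \<kappa>" and x: "x \<in> {0..1}"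
  shows "triangle_density \<kappa> x =
    1 / 2 * (LINT y:{0..1}|lborel. LINT z:{0..1}|lborel. \<kappa> x y * \<kappa> y z * \<kappa> z x)"
proof -
  define k where "k = (\<lambda>(x, y). indicator ({0..1} \<times> {0..1}) (x, y) *\<^sub>R \<kappa> x y :: real)"
  have sq: "{0..1} \<times> {0..1} \<in> sets (borel :: (real \<times> real) measure)"
    by (intro borel_closed closed_Times) auto
  have "(\<lambda>p. indicator ({0..1} \<times> {0..1}) p *\<^sub>R (\<lambda>(x, y). \<kappa> x y) p) \<in> borel_measurable borel"
    using assms(1) sq unfolding graphon_def
    by (subst (asm) borel_measurable_restrict_space_iff) auto
  moreover have "(\<lambda>p. indicator ({0..1} \<times> {0..1}) p *\<^sub>R (\<lambda>(x, y). \<kappa> x y) p) = k"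
    by (auto simp: k_def fun_eq_iff)
  ultimately have k[measurable]: "k \<in> borel_measurable (borel \<Otimes>\<^sub>M borel)"
    by (simp add: borel_prod)
  define F where "F = (\<lambda>(y, z). k (x, y) * k (y, z) * k (z, x))"
  have k01: "0 \<le> k p" "k p \<le> 1" for p
    using assms(1) by (auto simp: k_def graphon_def indicator_def split: prod.splits)
  have F: "F (y, z) = indicator {0..1} y * (indicator {0..1} z * (\<kappa> x y * \<kappa> y z * \<kappa> z x))" for y z
    using x by (auto simp: F_def k_def indicator_def)
  have Fm: "F \<in> borel_measurable (lborel \<Otimes>\<^sub>M lborel)"
    unfolding F_def by measurable
  have Fb: "norm (F p) \<le> norm (indicator ({0..1} \<times> {0..1}) p :: real)" for p
  proof (cases "p \<in> {0..1} \<times> {0..1}")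
    case True
    then show ?thesis
      using k01 by (auto simp: F_def abs_mult intro!: mult_le_one split: prod.splits)
  next
    case False
    then have "F p = 0"
      by (cases p) (auto simp: F indicator_def)
    then show ?thesis by simp
  qed
  have int: "integrable (lborel \<Otimes>\<^sub>M lborel) F"
  proof (rule Bochner_Integration.integrable_bound[OF _ Fm])
    have "emeasure (lborel \<Otimes>\<^sub>M lborel) ({0..1::real} \<times> {0..1::real}) < \<infinity>"
      by (subst lborel.emeasure_pair_measure_Times) auto
    then show "integrable (lborel \<Otimes>\<^sub>M lborel) (indicator ({0..1::real} \<times> {0..1::real}) :: _ \<Rightarrow> real)"
      by (intro integrable_real_indicator) auto
  qed (use Fb in auto)
  have "(LINT (y, z):{0..1} \<times> {0..1}|lborel. \<kappa> x y * \<kappa> y z * \<kappa> z x) = integral\<^sup>L (lborel \<Otimes>\<^sub>M lborel) F"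
    unfolding set_lebesgue_integral_def lborel_prod
    by (intro Bochner_Integration.integral_cong) (auto simp: F indicator_def)
  also have "\<dots> = (LINT y|lborel. LINT z|lborel. F (y, z))"
    using lborel_pair.integral_fst'[OF int] by simp
  also have "\<dots> = (LINT y:{0..1}|lborel. LINT z:{0..1}|lborel. \<kappa> x y * \<kappa> y z * \<kappa> z x)"
    unfolding set_lebesgue_integral_def F by simp
  finally show ?thesis
    unfolding triangle_density_def by simp
qed

lemma set_lborel_integral_cong:
  fixes f g :: "real \<Rightarrow> real"
  assumes "\<And>x. x \<in> {0..1} \<Longrightarrow> f x = g x"
  shows "(LINT x:{0..1}|lborel. f x) = (LINT x:{0..1}|lborel. g x)"
  by (rule set_lebesgue_integral_cong) (use assms in auto)

section \<open>Rank 1 graphons\<close>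

lemma chi_T_rank_one:
  fixes \<nu> :: "real \<Rightarrow> real"
  defines "m k \<equiv> LINT x:{0..1}|lborel. \<nu> x ^ k"
  assumes g: "graphon \<kappa>" and cont: "continuous_on {0..1} \<nu>"
    and pos: "\<And>x. x \<in> {0..1} \<Longrightarrow> \<nu> x > 0"
    and \<kappa>: "\<And>x y. x \<in> {0..1} \<Longrightarrow> y \<in> {0..1} \<Longrightarrow> \<kappa> x y = \<nu> x * \<nu> y"
  shows "chi_T \<kappa> = (m 2)\<^sup>2 / 2 * (m 3 / m 1 - m 2)"
proof -
  have si: "set_integrable lborel {0..1} (\<lambda>x. \<nu> x ^ k)" for k
    by (intro borel_integrable_atLeastAtMost' continuous_intros cont)
  have D: "degree_density \<kappa> x = \<nu> x * m 1" if "x \<in> {0..1}" for x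
  proof -
    have "degree_density \<kappa> x = (LINT y:{0..1}|lborel. \<nu> x * \<nu> y ^ 1)"
      unfolding degree_density_def by (rule set_lborel_integral_cong) (use \<kappa> that in auto)
    then show ?thesis by (simp add: m_def)
  qed
  have T: "triangle_density \<kappa> x = (m 2)\<^sup>2 / 2 * \<nu> x ^ 2" if x: "x \<in> {0..1}" for x
  proof -
    have "(LINT y:{0..1}|lborel. LINT z:{0..1}|lborel. \<kappa> x y * \<kappa> y z * \<kappa> z x)
        = (LINT y:{0..1}|lborel. LINT z:{0..1}|lborel. (\<nu> x ^ 2 * \<nu> y ^ 2) * \<nu> z ^ 2)"
      by (intro set_lborel_integral_cong) (use \<kappa> x in \<open>auto simp: power2_eq_square\<close>)
    also have "\<dots> = (LINT y:{0..1}|lborel. (\<nu> x ^ 2 * m 2) * \<nu> y ^ 2)"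
      unfolding set_integral_mult_right m_def by (simp add: mult_ac)
    also have "\<dots> = \<nu> x ^ 2 * m 2 * m 2"
      unfolding set_integral_mult_right m_def[symmetric] by simp
    finally show ?thesis
      by (simp add: triangle_density_iterated[OF g x] power2_eq_square)
  qed
  have N: "(LINT y:{0..1}|lborel. \<kappa> x y * triangle_density \<kappa> y) = \<nu> x * (m 2)\<^sup>2 / 2 * m 3"
    if x: "x \<in> {0..1}" for x
  proof -
    have "(LINT y:{0..1}|lborel. \<kappa> x y * triangle_density \<kappa> y)
        = (LINT y:{0..1}|lborel. (\<nu> x * (m 2)\<^sup>2 / 2) * \<nu> y ^ 3)"
      by (rule set_lborel_integral_cong) (use \<kappa> x T in \<open>auto simp: power2_eq_square power3_eq_cube\<close>)
    then show ?thesis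
      unfolding set_integral_mult_right m_def[symmetric] by simp
  qed
  \<comment> \<open>The constant term carries a factor \<open>\<nu> x ^ 0\<close> so that it too integrates to a moment, \<open>m 0\<close>.\<close>
  have "chi_T \<kappa> = (LINT x:{0..1}|lborel. (m 2)\<^sup>2 / 2 * m 3 / m 1 * \<nu> x ^ 0 - (m 2)\<^sup>2 / 2 * \<nu> x ^ 2)"
    unfolding chi_T_def
  proof (rule set_lborel_integral_cong)
    fix x :: real assume x: "x \<in> {0..1}"
    show "1 / degree_density \<kappa> x * (LINT y:{0..1}|lborel. \<kappa> x y * triangle_density \<kappa> y)
       - triangle_density \<kappa> x = (m 2)\<^sup>2 / 2 * m 3 / m 1 * \<nu> x ^ 0 - (m 2)\<^sup>2 / 2 * \<nu> x ^ 2"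
      unfolding D[OF x] N[OF x] T[OF x] using pos[OF x] by simp
  qed
  also have "\<dots> = (m 2)\<^sup>2 / 2 * m 3 / m 1 * m 0 - (m 2)\<^sup>2 / 2 * m 2"
    by (subst set_integral_diff(2))
      (use si in \<open>simp_all only: set_integral_mult_right m_def set_integrable_mult_right\<close>)
  also have "m 0 = 1"
    by (simp add: m_def set_lebesgue_integral_def)
  finally show ?thesis by (simp add: algebra_simps)
qed

text \<open>Centring both factors at \<open>m\<^sub>1\<close> rather than at their own means leaves the covariance
  unchanged, because \<open>\<nu> - m\<^sub>1\<close> has mean zero, and makes the integrand
  \<open>(\<nu> - m\<^sub>1)(\<nu>\<^sup>2 - m\<^sub>1\<^sup>2)\<close> a visibly nonnegative function.\<close>

lemma moment_covariance:
  fixes \<nu> :: "real \<Rightarrow> real"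
  defines "m k \<equiv> LINT x:{0..1}|lborel. \<nu> x ^ k"
  assumes cont: "continuous_on {0..1} \<nu>"
  shows "(LINT x:{0..1}|lborel. (\<nu> x - m 1)\<^sup>2 * (\<nu> x + m 1)) = m 3 - m 1 * m 2"
proof -
  have si: "set_integrable lborel {0..1} (\<lambda>x. c * \<nu> x ^ k)" for k and c :: real
    by (intro borel_integrable_atLeastAtMost' continuous_intros cont)
  have m0: "m 0 = 1"
    by (simp add: m_def set_lebesgue_integral_def)
  have "(LINT x:{0..1}|lborel. (\<nu> x - m 1)\<^sup>2 * (\<nu> x + m 1)) =
      (LINT x:{0..1}|lborel. (1 * \<nu> x ^ 3 - m 1 * \<nu> x ^ 2) - ((m 1)\<^sup>2 * \<nu> x ^ 1 - (m 1) ^ 3 * \<nu> x ^ 0))"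
    by (rule set_lborel_integral_cong) (simp add: power2_eq_square power3_eq_cube algebra_simps)
  also have "\<dots> = (1 * m 3 - m 1 * m 2) - ((m 1)\<^sup>2 * m 1 - (m 1) ^ 3 * m 0)"
    using si by (simp only: set_integral_diff set_integral_mult_right m_def)
  finally show ?thesis
    by (simp add: m0 power2_eq_square power3_eq_cube)
qed

lemma set_lborel_integral_continuous_pos:
  fixes f :: "real \<Rightarrow> real"
  assumes cont: "continuous_on {0..1} f" and nn: "\<And>x. x \<in> {0..1} \<Longrightarrow> f x \<ge> 0"
    and a: "a \<in> {0..1}" "f a \<noteq> 0"
  shows "(LINT x:{0..1}|lborel. f x) > 0"
proof -
  have eq: "(LINT x:{0..1}|lborel. f x) = integral {0..1} f"
    by (rule set_borel_integral_eq_integral) (rule borel_integrable_atLeastAtMost'[OF cont])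
  have "integral {0..1} f \<noteq> 0"
    using integral_eq_0_iff[OF cont] nn a by auto
  moreover have "integral {0..1} f \<ge> 0"
    by (rule Henstock_Kurzweil_Integration.integral_nonneg) 
       (use cont nn in \<open>auto intro: integrable_continuous_real\<close>)
  ultimately show ?thesis using eq by simp
qed

lemma chi_T_rank_one_sign:
  assumes g: "graphon \<kappa>" and cont: "continuous_on {0..1} \<nu>"
    and pos: "\<And>x. x \<in> {0..1} \<Longrightarrow> \<nu> x > 0"
    and \<kappa>: "\<And>x y. x \<in> {0..1} \<Longrightarrow> y \<in> {0..1} \<Longrightarrow> \<kappa> x y = \<nu> x * \<nu> y"
  shows "chi_T \<kappa> \<ge> 0 \<and> (chi_T \<kappa> = 0 \<longleftrightarrow> \<nu> constant_on {0..1})"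
proof -
  define m where "m k = (LINT x:{0..1}|lborel. \<nu> x ^ k)" for k
  define V where "V = (LINT x:{0..1}|lborel. (\<nu> x - m 1)\<^sup>2 * (\<nu> x + m 1))"
  have m_pos: "m k > 0" for k
    unfolding m_def
    by (rule set_lborel_integral_continuous_pos[where a=0])
      (use pos in \<open>auto intro!: continuous_intros cont simp: less_imp_le less_imp_neq[symmetric]\<close>)
  have "V = m 3 - m 1 * m 2"
    using moment_covariance[OF cont] by (simp add: V_def m_def)
  then have "m 3 / m 1 - m 2 = V / m 1"
    using m_pos[of 1] by (simp add: diff_divide_distrib del: One_nat_def)
  then have chi: "chi_T \<kappa> = (m 2)\<^sup>2 / (2 * m 1) * V"
    using chi_T_rank_one[OF g cont pos \<kappa>, folded m_def] by (simp del: One_nat_def)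
  have c: "(m 2)\<^sup>2 / (2 * m 1) > 0"
    using m_pos[of 1] m_pos[of 2] by (simp del: One_nat_def)
  have nn: "(\<nu> x - m 1)\<^sup>2 * (\<nu> x + m 1) \<ge> 0" if "x \<in> {0..1}" for x
    using pos[OF that] m_pos[of 1] by simp
  have V_pos: "V > 0" if "a \<in> {0..1}" "\<nu> a \<noteq> m 1" for a
    unfolding V_def
  proof (rule set_lborel_integral_continuous_pos)
    show "(\<nu> a - m 1)\<^sup>2 * (\<nu> a + m 1) \<noteq> 0"
      using that pos[of a] m_pos[of 1] by simp
  qed (use that nn in \<open>auto intro!: continuous_intros cont\<close>)
  have V_0: "V = 0" if "\<And>a. a \<in> {0..1} \<Longrightarrow> \<nu> a = m 1"
  proof -
    have "V = (LINT x:{0..1::real}|lborel. 0)"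
      unfolding V_def by (rule set_lborel_integral_cong) (use that in simp)
    then show ?thesis by (simp add: set_lebesgue_integral_def)
  qed
  have const: "\<nu> a = m 1" if "\<nu> constant_on {0..1}" "a \<in> {0..1}" for a
  proof -
    have "m 1 = (LINT x:{0..1::real}|lborel. \<nu> a)"
      unfolding m_def by (rule set_lborel_integral_cong) (use that in \<open>auto simp: constant_on_def\<close>)
    then show ?thesis by (simp add: set_lebesgue_integral_def)
  qed
  have "V \<ge> 0"
    using V_pos V_0 by (metis less_imp_le order_refl)
  moreover have "V = 0 \<longleftrightarrow> \<nu> constant_on {0..1}"
    using V_pos V_0 const unfolding constant_on_def by (metis less_irrefl)
  ultimately show ?thesis
    unfolding chi using c by (metis less_irrefl mult_eq_0_iff mult_nonneg_nonneg less_imp_le)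
qed

section \<open>Two-block graphons\<close>

lemma integral_two_step:
  fixes f :: "real \<Rightarrow> real"
  assumes p: "p \<in> {0..1}" and f: "\<And>x. x \<in> {0..1} \<Longrightarrow> f x = (if x \<le> p then a else b)"
  shows "(LINT x:{0..1}|lborel. f x) = p * a + (1 - p) * b"
proof -
  have "(LINT x:{0..1}|lborel. f x)
      = (LINT x|lborel. a * indicator {0..p} x + b * indicator {p<..1} x)"
    unfolding set_lebesgue_integral_def
    by (intro Bochner_Integration.integral_cong) (use p f in \<open>auto simp: indicator_def\<close>)
  also have "\<dots> = a * p + b * (1 - p)"
    using p by (subst Bochner_Integration.integral_add) auto
  finally show ?thesis by (simp add: mult_ac)
qed

text \<open>The average of \<open>\<T>\<close> over the neighbours of a vertex differs from \<open>\<T>\<close> at the vertex only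
  through the edges joining the two blocks, of which there is a proportion \<open>p (1-p) \<gamma>\<close>. Seen
  from the first block such an edge changes \<open>\<T>\<close> by \<open>T\<^sub>2 - T\<^sub>1\<close> and is chosen with weight
  \<open>1 / D\<^sub>1\<close>; seen from the second block the change is opposite and the weight is \<open>1 / D\<^sub>2\<close>.\<close>

lemma chi_T_two_block:
  fixes p \<alpha> \<beta> \<gamma> :: real
  defines "D1 \<equiv> p * \<alpha> + (1 - p) * \<gamma>" and "D2 \<equiv> p * \<gamma> + (1 - p) * \<beta>"
  defines "T1 \<equiv> (p\<^sup>2 * \<alpha> ^ 3 + 2 * p * (1 - p) * \<alpha> * \<gamma>\<^sup>2 + (1 - p)\<^sup>2 * \<beta> * \<gamma>\<^sup>2) / 2"
    and "T2 \<equiv> (p\<^sup>2 * \<alpha> * \<gamma>\<^sup>2 + 2 * p * (1 - p) * \<beta> * \<gamma>\<^sup>2 + (1 - p)\<^sup>2 * \<beta> ^ 3) / 2"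
  assumes g: "graphon \<kappa>" and p: "p \<in> {0..1}"
    and \<kappa>: "\<And>x y. x \<in> {0..1} \<Longrightarrow> y \<in> {0..1} \<Longrightarrow>
      \<kappa> x y = (if x \<le> p then if y \<le> p then \<alpha> else \<gamma> else if y \<le> p then \<gamma> else \<beta>)"
    and D: "D1 > 0" "D2 > 0"
  shows "\<And>x. x \<in> {0..1} \<Longrightarrow> degree_density \<kappa> x = (if x \<le> p then D1 else D2)"
    and "chi_T \<kappa> = p * (1 - p) * \<gamma> * (T1 - T2) * (1 / D2 - 1 / D1)"
proof -
  show deg: "degree_density \<kappa> x = (if x \<le> p then D1 else D2)" if "x \<in> {0..1}" for x
    unfolding degree_density_def
    by (subst integral_two_step[OF p, of _ "if x \<le> p then \<alpha> else \<gamma>" "if x \<le> p then \<gamma> else \<beta>"])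
      (use \<kappa> that in \<open>auto simp: D1_def D2_def\<close>)
  have T: "triangle_density \<kappa> x = (if x \<le> p then T1 else T2)" if x: "x \<in> {0..1}" for x
  proof -
    define u where "u = (if x \<le> p then \<alpha> else \<gamma>)"
    define v where "v = (if x \<le> p then \<gamma> else \<beta>)"
    have inner: "(LINT z:{0..1}|lborel. \<kappa> x y * \<kappa> y z * \<kappa> z x) =
       (if y \<le> p then u * (p * (\<alpha> * u) + (1 - p) * (\<gamma> * v))
        else v * (p * (\<gamma> * u) + (1 - p) * (\<beta> * v)))" if y: "y \<in> {0..1}" for y
      by (subst integral_two_step[OF p, of _ "if y \<le> p then u * \<alpha> * u else v * \<gamma> * u"
            "if y \<le> p then u * \<gamma> * v else v * \<beta> * v"])
        (use \<kappa> x y in \<open>auto simp: u_def v_def algebra_simps\<close>)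
    have "triangle_density \<kappa> x = 1 / 2 *
       (p * (u * (p * (\<alpha> * u) + (1 - p) * (\<gamma> * v)))
        + (1 - p) * (v * (p * (\<gamma> * u) + (1 - p) * (\<beta> * v))))"
      unfolding triangle_density_iterated[OF g x] by (subst integral_two_step[OF p inner]) auto
    then show ?thesis
      by (auto simp: u_def v_def T1_def T2_def field_simps power2_eq_square power3_eq_cube)
  qed
  have N: "(LINT y:{0..1}|lborel. \<kappa> x y * triangle_density \<kappa> y) =
     (if x \<le> p then p * (\<alpha> * T1) + (1 - p) * (\<gamma> * T2) else p * (\<gamma> * T1) + (1 - p) * (\<beta> * T2))"
    if x: "x \<in> {0..1}" for x
    by (subst integral_two_step[OF p, of _ "(if x \<le> p then \<alpha> else \<gamma>) * T1"
          "(if x \<le> p then \<gamma> else \<beta>) * T2"])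
      (use \<kappa> x T in auto)
  have "chi_T \<kappa> = p * (1 / D1 * (p * (\<alpha> * T1) + (1 - p) * (\<gamma> * T2)) - T1)
      + (1 - p) * (1 / D2 * (p * (\<gamma> * T1) + (1 - p) * (\<beta> * T2)) - T2)"
    unfolding chi_T_def by (rule integral_two_step[OF p]) (use deg N T in auto)
  also have "1 / D1 * (p * (\<alpha> * T1) + (1 - p) * (\<gamma> * T2)) - T1 = (1 - p) * \<gamma> * (T2 - T1) / D1"
  proof -
    have "p * (\<alpha> * T1) + (1 - p) * (\<gamma> * T2) - T1 * D1 = (1 - p) * \<gamma> * (T2 - T1)"
      by (simp add: D1_def algebra_simps)
    then show ?thesis using D by (simp add: field_simps)
  qed
  also have "1 / D2 * (p * (\<gamma> * T1) + (1 - p) * (\<beta> * T2)) - T2 = p * \<gamma> * (T1 - T2) / D2"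
  proof -
    have "p * (\<gamma> * T1) + (1 - p) * (\<beta> * T2) - T2 * D2 = p * \<gamma> * (T1 - T2)"
      by (simp add: D2_def algebra_simps)
    then show ?thesis using D by (simp add: field_simps)
  qed
  also have "p * ((1 - p) * \<gamma> * (T2 - T1) / D1) + (1 - p) * (p * \<gamma> * (T1 - T2) / D2)
      = p * (1 - p) * \<gamma> * (T1 - T2) * (1 / D2 - 1 / D1)"
    using D by (simp add: field_simps)
  finally show "chi_T \<kappa> = p * (1 - p) * \<gamma> * (T1 - T2) * (1 / D2 - 1 / D1)" .
qed

text \<open>With \<open>\<alpha> = 0\<close>, \<open>\<gamma> = 1\<close> the two requirements are \<open>\<beta> < 1 - r\<close> (for \<open>D\<^sub>1 > D\<^sub>2\<close>) and
  \<open>\<beta>\<^sup>2 > 1 - 2 r\<close> (for \<open>T\<^sub>1 < T\<^sub>2\<close>), where \<open>r = p / (1-p)\<close>. They are compatible for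
  \<open>0 < r < 1\<close> because \<open>(1 - r)\<^sup>2 > 1 - 2 r\<close>; the choice \<open>r = 1/2\<close> gives \<open>p = 1/3\<close> and
  leaves any \<open>\<beta>\<close> in \<open>(0, 1/2)\<close>.\<close>

lemma ex_two_block_chi_T_negative:
  "\<exists>\<kappa>. two_block_graphon \<kappa> \<and> (\<forall>x\<in>{0..1}. degree_density \<kappa> x > 0) \<and> chi_T \<kappa> < 0"
proof -
  define \<kappa> :: "real \<Rightarrow> real \<Rightarrow> real" where
    "\<kappa> x y = (if x \<le> 1/3 then if y \<le> 1/3 then 0 else 1 else if y \<le> 1/3 then 1 else 1/4)" for x y
  have "(\<lambda>(x, y). \<kappa> x y) \<in> borel_measurable (borel \<Otimes>\<^sub>M borel)"
    unfolding \<kappa>_def by measurable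
  then have g: "graphon \<kappa>"
    unfolding graphon_def borel_prod
    by (auto intro!: measurable_restrict_space1) (auto simp: \<kappa>_def)
  have tb: "two_block_graphon \<kappa>"
    unfolding two_block_graphon_def
    by (rule conjI[OF g], rule bexI[of _ "1/3"], rule bexI[of _ 0], rule bexI[of _ "1/4"],
        rule bexI[of _ 1])
      (auto simp: \<kappa>_def)
  note chi = chi_T_two_block[OF g, of "1/3" 0 1 "1/4", OF _ \<kappa>_def]
  show ?thesis
    by (rule exI[of _ \<kappa>]) (use tb chi in \<open>auto simp: power2_eq_square power3_eq_cube\<close>)
qed

theorem theorem7:
  shows "(\<forall>(\<kappa> :: real \<Rightarrow> real \<Rightarrow> real) (\<nu> :: real \<Rightarrow> real).
            graphon \<kappa> \<and>
            continuous_on ({0..1} \<times> {0..1}) (\<lambda>(x, y). \<kappa> x y) \<and>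
            (\<forall>x\<in>{0..1}. degree_density \<kappa> x > 0) \<and>
            \<nu> \<in> {0..1} \<rightarrow> {0..1} \<and>
            \<nu> \<in> borel_measurable (restrict_space borel {0..1}) \<and>
            (\<forall>x\<in>{0..1}. \<nu> x > 0) \<and>
            continuous_on {0..1} \<nu> \<and>
            (\<forall>x\<in>{0..1}. \<forall>y\<in>{0..1}. \<kappa> x y = \<nu> x * \<nu> y)
            \<longrightarrow> chi_T \<kappa> \<ge> 0 \<and> (chi_T \<kappa> = 0 \<longleftrightarrow> \<nu> constant_on {0..1}))
         \<and> (\<exists>\<kappa>. two_block_graphon \<kappa> \<and>
                (\<forall>x\<in>{0..1}. degree_density \<kappa> x > 0) \<and>
                chi_T \<kappa> < 0)"
  using chi_T_rank_one_sign ex_two_block_chi_T_negative by blast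

end
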